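(* Let $\omega=\phi'\,dz$ be a meromorphic differential, and let $W=\partial_\phi$ be its dual vector field, i.e. the vector field with $\omega(W)=1$, which is the velocity field of the moving curve $\Gamma_t$ given by the equipotentials of $\omega$. Let $\langle\ ,\ \rangle$ be any conformal metric, and let $Y$ be the ideal flow which is $\langle\ ,\ \rangle$-dual to $\omega$. Then $W$ is reciprocal to $Y$: for any such $\langle\ ,\ \rangle$, $W$ and $Y$ have the same directions, but reciprocal magnitudes (with respect to $\langle\ ,\ \rangle$), at all points where $\omega$ has neither zero nor pole.
   Context: In a local coordinate $z$, $\omega=d\phi=\phi'\,dz$ with complex potential $\phi=U+iV$, and $W=\partial_\phi=(1/\phi')\partial_z$. A conformal metric on $(1,0)$-vectors has the local form $\langle A\partial_z,B\partial_z\rangle=\rho^2A\bar B$ with $\rho>0$ a real function. The field $Y$ that is $\langle\ ,\ \rangle$-dual to $\omega$ is the one with $\langle X,Y\rangle=\omega(X)$ for every $(1,0)$-vector $X$; for the standard planar metric, $Y=\overline{\phi'(z)}\,\partial_z$, corresponding to $\nabla U$ (an ideal, i.e. locally sourceless and irrotational, flow). The magnitude of $X$ is $\langle X,X\rangle^{1/2}$. The equipotentials of $\omega$ are the curves $\mathrm{Re}[\omega]=0$, i.e. locally $\mathrm{Re}[\phi]=\mathrm{const}$. *)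

theory Defs
  imports "HOL-Complex_Analysis.Complex_Analysis"
begin

type_synonym 'a chart = "'a set \<times> ('a \<Rightarrow> complex)"

abbreviation patch :: "'a chart \<Rightarrow> 'a set" where "patch \<equiv> fst"
abbreviation coord :: "'a chart \<Rightarrow> 'a \<Rightarrow> complex" where "coord \<equiv> snd"

definition point :: "'a chart \<Rightarrow> complex \<Rightarrow> 'a" where
  "point c z = inv_into (patch c) (coord c) z"

definition transition :: "'a chart \<Rightarrow> 'a chart \<Rightarrow> complex \<Rightarrow> complex" where
  "transition c d z = coord d (point c z)"

definition riemann_surface :: "'a topology \<Rightarrow> 'a chart set \<Rightarrow> bool" where
  "riemann_surface M A \<longleftrightarrow>
     Hausdorff_space M \<and> connected_space M \<and> topspace M = (\<Union>c\<in>A. patch c) \<and>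
     (\<forall>c\<in>A. openin M (patch c) \<and> open (coord c ` patch c) \<and>
        homeomorphic_map (subtopology M (patch c)) (top_of_set (coord c ` patch c)) (coord c)) \<and>
     (\<forall>c\<in>A. \<forall>d\<in>A. transition c d holomorphic_on coord c ` (patch c \<inter> patch d))"

text \<open>
  A meromorphic differential is given by its coefficients: \<open>\<omega> c z\<close> is the function \<open>f\<close> with
  \<open>\<omega> = f dz\<close> in the coordinate of the chart \<open>c\<close>.
  The predicate \<open>nicely_meromorphic_on\<close> excludes removable singularities and fixes the
  (irrelevant) value at a pole to be \<open>0\<close>.
\<close>

definition meromorphic_differential ::
    "'a chart set \<Rightarrow> ('a chart \<Rightarrow> complex \<Rightarrow> complex) \<Rightarrow> bool" where
  "meromorphic_differential A \<omega> \<longleftrightarrow>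
     (\<forall>c\<in>A. \<omega> c nicely_meromorphic_on coord c ` patch c) \<and>
     (\<forall>c\<in>A. \<forall>d\<in>A. \<forall>z\<in>coord c ` (patch c \<inter> patch d).
        \<omega> c z = \<omega> d (transition c d z) * deriv (transition c d) z)"

definition poles :: "'a chart set \<Rightarrow> ('a chart \<Rightarrow> complex \<Rightarrow> complex) \<Rightarrow> 'a set" where
  "poles A \<omega> = {p. \<exists>c\<in>A. p \<in> patch c \<and> is_pole (\<omega> c) (coord c p)}"

definition zeros :: "'a chart set \<Rightarrow> ('a chart \<Rightarrow> complex \<Rightarrow> complex) \<Rightarrow> 'a set" where
  "zeros A \<omega> = {p. \<exists>c\<in>A. p \<in> patch c \<and> \<not> is_pole (\<omega> c) (coord c p) \<and> \<omega> c (coord c p) = 0}"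

definition nonpoles :: "'a chart set \<Rightarrow> ('a chart \<Rightarrow> complex \<Rightarrow> complex) \<Rightarrow> 'a set" where
  "nonpoles A \<omega> = (\<Union>c\<in>A. patch c) - poles A \<omega>"

definition regular_points :: "'a chart set \<Rightarrow> ('a chart \<Rightarrow> complex \<Rightarrow> complex) \<Rightarrow> 'a set" where
  "regular_points A \<omega> = nonpoles A \<omega> - zeros A \<omega>"

text \<open>
  A \<open>(1,0)\<close>-vector at \<open>p\<close> is given by its components: \<open>X c\<close> is the number \<open>a\<close> with
  \<open>X = a \<partial>\<^sub>z\<close> in the coordinate of \<open>c\<close>. Components at charts that do not contain \<open>p\<close> are
  set to \<open>0\<close>, so that equality of vectors is equality of functions. As usual, \<open>a \<partial>\<^sub>z\<close> is also
  regarded as the real tangent vector \<open>Re a \<partial>\<^sub>x + Im a \<partial>\<^sub>y\<close>, i.e. the velocity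
  \<open>dz/dt = a\<close>.
\<close>

type_synonym 'a vec10 = "'a chart \<Rightarrow> complex"

definition tangent :: "'a chart set \<Rightarrow> 'a \<Rightarrow> 'a vec10 set" where
  "tangent A p = {X.
     (\<forall>c\<in>A. \<forall>d\<in>A. p \<in> patch c \<inter> patch d \<longrightarrow> X d = deriv (transition c d) (coord c p) * X c) \<and>
     (\<forall>c. \<not> (c \<in> A \<and> p \<in> patch c) \<longrightarrow> X c = 0)}"

text \<open>
  The pairing \<open>\<omega>(X)\<close> and the metric below do not depend on the chart in which they are computed.
\<close>

definition chart_at :: "'a chart set \<Rightarrow> 'a \<Rightarrow> 'a chart" where
  "chart_at A p = (SOME c. c \<in> A \<and> p \<in> patch c)"

definition pairing ::
    "'a chart set \<Rightarrow> ('a chart \<Rightarrow> complex \<Rightarrow> complex) \<Rightarrow> 'a \<Rightarrow> 'a vec10 \<Rightarrow> complex" where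
  "pairing A \<omega> p X = (let c = chart_at A p in \<omega> c (coord c p) * X c)"

definition conformal_metric ::
    "'a chart set \<Rightarrow> ('a chart \<Rightarrow> complex \<Rightarrow> real) \<Rightarrow> bool" where
  "conformal_metric A \<rho> \<longleftrightarrow>
     (\<forall>c\<in>A. \<forall>z\<in>coord c ` patch c. \<rho> c z > 0) \<and>
     (\<forall>c\<in>A. \<forall>d\<in>A. \<forall>z\<in>coord c ` (patch c \<inter> patch d).
        \<rho> c z = \<rho> d (transition c d z) * norm (deriv (transition c d) z))"

definition herm_metric ::
    "'a chart set \<Rightarrow> ('a chart \<Rightarrow> complex \<Rightarrow> real) \<Rightarrow> 'a \<Rightarrow> 'a vec10 \<Rightarrow> 'a vec10 \<Rightarrow> complex" where
  "herm_metric A \<rho> p X Y =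
     (let c = chart_at A p in of_real ((\<rho> c (coord c p))\<^sup>2) * X c * cnj (Y c))"

definition magnitude ::
    "'a chart set \<Rightarrow> ('a chart \<Rightarrow> complex \<Rightarrow> real) \<Rightarrow> 'a \<Rightarrow> 'a vec10 \<Rightarrow> real" where
  "magnitude A \<rho> p X = sqrt (Re (herm_metric A \<rho> p X X))"

definition same_direction :: "'a vec10 \<Rightarrow> 'a vec10 \<Rightarrow> bool" where
  "same_direction X Y \<longleftrightarrow>
     X \<noteq> (\<lambda>c. 0) \<and> Y \<noteq> (\<lambda>c. 0) \<and> (\<exists>l::real. l > 0 \<and> X = (\<lambda>c. of_real l * Y c))"

definition dual_vector_field ::
    "'a chart set \<Rightarrow> ('a chart \<Rightarrow> complex \<Rightarrow> complex) \<Rightarrow> ('a \<Rightarrow> 'a vec10) \<Rightarrow> bool" where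
  "dual_vector_field A \<omega> W \<longleftrightarrow>
     (\<forall>p\<in>regular_points A \<omega>. W p \<in> tangent A p \<and> pairing A \<omega> p (W p) = 1)"

definition metric_dual ::
    "'a chart set \<Rightarrow> ('a chart \<Rightarrow> complex \<Rightarrow> real) \<Rightarrow> ('a chart \<Rightarrow> complex \<Rightarrow> complex) \<Rightarrow>
     ('a \<Rightarrow> 'a vec10) \<Rightarrow> bool" where
  "metric_dual A \<rho> \<omega> Y \<longleftrightarrow>
     (\<forall>p\<in>nonpoles A \<omega>. Y p \<in> tangent A p \<and>
        (\<forall>X\<in>tangent A p. herm_metric A \<rho> p X (Y p) = pairing A \<omega> p X))"

text \<open>
  For a real vector field \<open>a \<partial>\<^sub>x + b \<partial>\<^sub>y\<close> and the metric \<open>\<rho>\<^sup>2(dx\<^sup>2 + dy\<^sup>2)\<close>,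
  the divergence is \<open>\<rho>\<^sup>-\<^sup>2 ((\<rho>\<^sup>2 a)\<^sub>x + (\<rho>\<^sup>2 b)\<^sub>y)\<close> and the curl is
  \<open>\<rho>\<^sup>-\<^sup>2 ((\<rho>\<^sup>2 b)\<^sub>x - (\<rho>\<^sup>2 a)\<^sub>y)\<close>. In \<open>ideal_flow\<close>, \<open>a + ib\<close> is the component of the field
  and \<open>D\<close> is the derivative of \<open>\<rho>\<^sup>2(a + ib)\<close>. Only this product has to be differentiable, as no
  regularity of \<open>\<rho>\<close> is assumed.
\<close>

definition ideal_flow ::
    "'a chart set \<Rightarrow> ('a chart \<Rightarrow> complex \<Rightarrow> real) \<Rightarrow> 'a set \<Rightarrow> ('a \<Rightarrow> 'a vec10) \<Rightarrow> bool" where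
  "ideal_flow A \<rho> S Y \<longleftrightarrow>
     (\<forall>c\<in>A. \<forall>z\<in>coord c ` (patch c \<inter> S). \<exists>D.
        ((\<lambda>\<zeta>. of_real ((\<rho> c \<zeta>)\<^sup>2) * Y (point c \<zeta>) c) has_derivative D) (at z) \<and>
        (Re (D 1) + Im (D \<i>)) / (\<rho> c z)\<^sup>2 = 0 \<and>
        (Im (D 1) - Re (D \<i>)) / (\<rho> c z)\<^sup>2 = 0)"

text \<open>
  \<open>potential A \<omega> c V \<phi>\<close>: on the open set \<open>V\<close> of regular points, seen in the coordinate of \<open>c\<close>,
  \<open>\<phi>\<close> is a complex potential, \<open>\<omega> = d\<phi>\<close>. The equipotentials there are the level sets of \<open>Re \<phi>\<close>.
\<close>

definition potential ::
    "'a chart set \<Rightarrow> ('a chart \<Rightarrow> complex \<Rightarrow> complex) \<Rightarrow> 'a chart \<Rightarrow> complex set \<Rightarrow>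
     (complex \<Rightarrow> complex) \<Rightarrow> bool" where
  "potential A \<omega> c V \<phi> \<longleftrightarrow>
     open V \<and> V \<subseteq> coord c ` (patch c \<inter> regular_points A \<omega>) \<and>
     (\<forall>z\<in>V. (\<phi> has_field_derivative \<omega> c z) (at z))"

text \<open>
  \<open>W\<close> is the velocity field of the moving curve \<open>\<Gamma>\<^sub>t = {Re \<phi> = t}\<close>: near each regular point
  \<open>z\<^sub>0\<close>, the curves \<open>\<Gamma>\<^sub>t\<close> have regular parametrizations \<open>s \<mapsto> \<gamma> t s\<close>
  such that the point \<open>\<gamma> t s\<close> moves with velocity \<open>W\<close>, in the direction normal to the curve
  (normality being the same for all conformal metrics).
\<close>

definition velocity_of_equipotentials ::
    "'a chart set \<Rightarrow> ('a chart \<Rightarrow> complex \<Rightarrow> complex) \<Rightarrow> ('a \<Rightarrow> 'a vec10) \<Rightarrow> bool" where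
  "velocity_of_equipotentials A \<omega> W \<longleftrightarrow>
     (\<forall>c\<in>A. \<forall>V \<phi>. potential A \<omega> c V \<phi> \<longrightarrow> (\<forall>z0\<in>V.
        \<exists>N (\<epsilon>::real) (\<gamma> :: real \<Rightarrow> real \<Rightarrow> complex).
          open N \<and> z0 \<in> N \<and> N \<subseteq> V \<and> \<epsilon> > 0 \<and> \<gamma> (Re (\<phi> z0)) 0 = z0 \<and>
          (\<forall>t. \<bar>t - Re (\<phi> z0)\<bar> < \<epsilon> \<longrightarrow>
             bij_betw (\<gamma> t) {s. \<bar>s\<bar> < \<epsilon>} {z\<in>N. Re (\<phi> z) = t} \<and>
             (\<forall>s. \<bar>s\<bar> < \<epsilon> \<longrightarrow>
                ((\<lambda>\<tau>. \<gamma> \<tau> s) has_vector_derivative W (point c (\<gamma> t s)) c) (at t) \<and>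
                (\<exists>T. (\<gamma> t has_vector_derivative T) (at s) \<and> T \<noteq> 0 \<and>
                     Re (W (point c (\<gamma> t s)) c * cnj T) = 0)))))"

end

theory Submission
  imports Defs
begin

text \<open>
  In a chart, \<open>W = 1/f\<close> and \<open>Y = cnj f / \<rho>\<^sup>2\<close> where \<open>\<omega> = f dz\<close>. Hence \<open>W = (\<rho>\<^sup>2/|f|\<^sup>2) Y\<close>, with
  magnitudes \<open>\<rho>/|f|\<close> and \<open>|f|/\<rho>\<close>. The flow \<open>Y\<close> is ideal because \<open>\<rho>\<^sup>2 Y = cnj f\<close> is antiholomorphic.
  A local inverse \<open>\<psi>\<close> of a complex potential \<open>\<phi>\<close> straightens the equipotentials:
  \<open>s \<mapsto> \<psi> (t + \<i> s)\<close> parametrizes \<open>Re \<phi> = t\<close>, and \<open>\<partial>\<^sub>t \<psi> = 1/f = W\<close> is orthogonal to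
  \<open>\<partial>\<^sub>s \<psi> = \<i>/f\<close>.
\<close>

section \<open>Local parametrization of the equipotentials\<close>

lemma equipotential_flow_box:
  fixes \<phi> f :: "complex \<Rightarrow> complex"
  assumes V: "open V" "z0 \<in> V"
    and der: "\<And>z. z \<in> V \<Longrightarrow> (\<phi> has_field_derivative f z) (at z)"
    and nz: "\<And>z. z \<in> V \<Longrightarrow> f z \<noteq> 0"
  obtains N and \<epsilon> :: real and \<gamma> :: "real \<Rightarrow> real \<Rightarrow> complex"
  where "open N" "z0 \<in> N" "N \<subseteq> V" "\<epsilon> > 0" "\<gamma> (Re (\<phi> z0)) 0 = z0"
    and "\<And>t. \<bar>t - Re (\<phi> z0)\<bar> < \<epsilon> \<Longrightarrow> bij_betw (\<gamma> t) {s. \<bar>s\<bar> < \<epsilon>} {z\<in>N. Re (\<phi> z) = t}"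
    and "\<And>t s. \<bar>t - Re (\<phi> z0)\<bar> < \<epsilon> \<Longrightarrow> \<bar>s\<bar> < \<epsilon> \<Longrightarrow>
      ((\<lambda>\<tau>. \<gamma> \<tau> s) has_vector_derivative 1 / f (\<gamma> t s)) (at t)"
    and "\<And>t s. \<bar>t - Re (\<phi> z0)\<bar> < \<epsilon> \<Longrightarrow> \<bar>s\<bar> < \<epsilon> \<Longrightarrow>
      (\<gamma> t has_vector_derivative \<i> / f (\<gamma> t s)) (at s)"
proof -
  have hol: "\<phi> holomorphic_on V"
    using der V(1) by (auto simp: holomorphic_on_open)
  have "deriv \<phi> z0 \<noteq> 0"
    using der[OF V(2)] nz[OF V(2)] by (simp add: DERIV_imp_deriv)
  then obtain r where r: "r > 0" "ball z0 r \<subseteq> V" "open (\<phi> ` ball z0 r)" "inj_on \<phi> (ball z0 r)"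
    using has_complex_derivative_locally_invertible[OF hol V(2,1)] by metis
  have contb: "continuous_on (ball z0 r) \<phi>"
    using hol r(2) holomorphic_on_imp_continuous_on holomorphic_on_subset by blast
  define \<psi> where "\<psi> = the_inv_into (ball z0 r) \<phi>"
  have \<psi>\<phi>: "\<psi> (\<phi> z) = z" if "z \<in> ball z0 r" for z
    unfolding \<psi>_def by (rule the_inv_into_f_f[OF r(4) that])
  have z0: "z0 \<in> ball z0 r"
    using r(1) by simp
  obtain \<delta> where \<delta>: "\<delta> > 0" "ball (\<phi> z0) \<delta> \<subseteq> \<phi> ` ball z0 r"
    using r(3) z0 open_contains_ball by blast
  \<comment> \<open>Half of \<delta> suffices because the modulus is at most the sum of the absolute
    values of the real and imaginary parts: the open square \<open>B\<close> of half-side \<epsilon>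
    then lies in the disc of radius \<delta>.\<close>
  define \<epsilon> where "\<epsilon> = \<delta> / 2"
  define B where "B = {w. \<bar>Re w - Re (\<phi> z0)\<bar> < \<epsilon> \<and> \<bar>Im w - Im (\<phi> z0)\<bar> < \<epsilon>}"
  have "w \<in> ball (\<phi> z0) \<delta>" if "w \<in> B" for w
    using that cmod_le[of "w - \<phi> z0"] by (auto simp: B_def \<epsilon>_def dist_commute dist_norm)
  then have B: "B \<subseteq> \<phi> ` ball z0 r"
    using \<delta>(2) by blast
  have \<psi>B: "\<psi> w \<in> ball z0 r" "\<phi> (\<psi> w) = w" if "w \<in> B" for w
    using that B \<psi>\<phi> by auto
  have "open B"
    unfolding B_def by (intro open_Collect_conj open_Collect_less continuous_intros)
  \<comment> \<open>Cutting the ball down to the preimage of a square makes every equipotential in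
    \<open>N\<close> correspond to a full vertical segment of the same length, so one \<epsilon>
    serves for all t and s. The shift by \<open>Im (\<phi> z0)\<close> in \<gamma> puts
    \<open>z0\<close> at parameter 0.\<close>
  define N where "N = ball z0 r \<inter> \<phi> -` B"
  define \<gamma> where "\<gamma> t s = \<psi> (Complex t (Im (\<phi> z0) + s))" for t s
  have inB: "Complex t (Im (\<phi> z0) + s) \<in> B" if "\<bar>t - Re (\<phi> z0)\<bar> < \<epsilon>" "\<bar>s\<bar> < \<epsilon>" for t s
    using that by (simp add: B_def)
  have der\<psi>: "(\<psi> has_field_derivative 1 / f (\<gamma> t s)) (at (Complex t (Im (\<phi> z0) + s)))"
    if "\<bar>t - Re (\<phi> z0)\<bar> < \<epsilon>" "\<bar>s\<bar> < \<epsilon>" for t s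
  proof -
    note ts = \<psi>B[OF inB[OF that], folded \<gamma>_def]
    then have "\<gamma> t s \<in> V"
      using r(2) by blast
    \<comment> \<open>The inverse function theorem is applied at the point
      \<open>\<gamma> t s\<close>, whose image under \<phi> is
      \<open>Complex t (Im (\<phi> z0) + s)\<close>. It gives the reciprocal of the derivative of
      \<phi>.\<close>
    from has_field_derivative_inverse_strong[OF der nz open_ball ts(1) contb, OF this this \<psi>\<phi>]
    show ?thesis
      by (simp add: ts(2) field_simps)
  qed
  show thesis
  proof (rule that[of N \<epsilon> \<gamma>])
    show "open N"
      unfolding N_def by (rule continuous_open_preimage[OF contb open_ball \<open>open B\<close>])
    show "z0 \<in> N"
      using z0 \<delta>(1) by (simp add: N_def B_def \<epsilon>_def)
    show "N \<subseteq> V" "\<epsilon> > 0"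
      using r(2) \<delta>(1) by (auto simp: N_def \<epsilon>_def)
    show "\<gamma> (Re (\<phi> z0)) 0 = z0"
      using \<psi>\<phi>[OF z0] by (simp add: \<gamma>_def)
  next
    fix t assume t: "\<bar>t - Re (\<phi> z0)\<bar> < \<epsilon>"
    show "bij_betw (\<gamma> t) {s. \<bar>s\<bar> < \<epsilon>} {z\<in>N. Re (\<phi> z) = t}"
    \<comment> \<open>On an equipotential the real part of \<phi> is already known to be t, so the
      imaginary part alone recovers the parameter.\<close>
    proof (rule bij_betw_byWitness[where f' = "\<lambda>z. Im (\<phi> z) - Im (\<phi> z0)"])
      show "\<forall>s\<in>{s. \<bar>s\<bar> < \<epsilon>}. Im (\<phi> (\<gamma> t s)) - Im (\<phi> z0) = s"
        using \<psi>B(2) inB[OF t] by (simp add: \<gamma>_def)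
      show "\<forall>z\<in>{z\<in>N. Re (\<phi> z) = t}. \<gamma> t (Im (\<phi> z) - Im (\<phi> z0)) = z"
        using \<psi>\<phi> by (auto simp: \<gamma>_def N_def)
      show "\<gamma> t ` {s. \<bar>s\<bar> < \<epsilon>} \<subseteq> {z\<in>N. Re (\<phi> z) = t}"
        using \<psi>B inB[OF t] by (auto simp: \<gamma>_def N_def simp del: mem_ball)
      show "(\<lambda>z. Im (\<phi> z) - Im (\<phi> z0)) ` {z\<in>N. Re (\<phi> z) = t} \<subseteq> {s. \<bar>s\<bar> < \<epsilon>}"
        by (auto simp: N_def B_def)
    qed
  next
    fix t s assume ts: "\<bar>t - Re (\<phi> z0)\<bar> < \<epsilon>" "\<bar>s\<bar> < \<epsilon>"
    \<comment> \<open>In the plane of values of \<phi>, varying t runs along a horizontal line with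
      velocity 1, and varying s, below, along a vertical line with velocity \<i>. The chain rule
      multiplies each by the derivative \<open>1 / f\<close> of \<psi>.\<close>
    have "((\<lambda>\<tau>. Complex \<tau> (Im (\<phi> z0) + s)) has_vector_derivative 1) (at t)"
      unfolding Complex_eq by (auto intro!: derivative_eq_intros)
    from field_vector_diff_chain_at[OF this der\<psi>[OF ts]]
    show "((\<lambda>\<tau>. \<gamma> \<tau> s) has_vector_derivative 1 / f (\<gamma> t s)) (at t)"
      by (simp add: \<gamma>_def o_def)
    have "((\<lambda>s. Complex t (Im (\<phi> z0) + s)) has_vector_derivative \<i>) (at s)"
      unfolding Complex_eq by (auto intro!: derivative_eq_intros)
    from field_vector_diff_chain_at[OF this der\<psi>[OF ts]]
    show "(\<gamma> t has_vector_derivative \<i> / f (\<gamma> t s)) (at s)"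
      by (simp add: \<gamma>_def[abs_def] o_def)
  qed
qed

section \<open>Charts and transition maps\<close>

lemma point_coord:
  assumes "riemann_surface M A" "c \<in> A" "p \<in> patch c"
  shows "point c (coord c p) = p"
proof -
  have "inj_on (coord c) (topspace (subtopology M (patch c)))"
    using assms homeomorphic_imp_injective_map unfolding riemann_surface_def by blast
  moreover have "patch c \<subseteq> topspace M"
    using assms unfolding riemann_surface_def by (metis openin_subset)
  ultimately show ?thesis
    using assms(3) by (simp add: point_def Int_absorb1)
qed

lemma transition_coord:
  assumes "riemann_surface M A" "c \<in> A" "p \<in> patch c"
  shows "transition c d (coord c p) = coord d p"
  using point_coord[OF assms] by (simp add: transition_def)

text \<open>A chart is an open map only onto its image with the subspace topology. Since that image
  is open in the plane, relative openness becomes openness, and local identities on overlaps can be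
  differentiated.\<close>

lemma open_coord_overlap:
  assumes "riemann_surface M A" "c \<in> A" "openin M U"
  shows "open (coord c ` (patch c \<inter> U))"
proof -
  have c: "open (coord c ` patch c)"
      "homeomorphic_map (subtopology M (patch c)) (top_of_set (coord c ` patch c)) (coord c)"
    using assms unfolding riemann_surface_def by blast+
  have "openin (subtopology M (patch c)) (patch c \<inter> U)"
    using assms(3) by (auto simp: openin_subtopology)
  then have "openin (top_of_set (coord c ` patch c)) (coord c ` (patch c \<inter> U))"
    using homeomorphic_imp_open_map[OF c(2)] by (simp add: open_map_def)
  then show ?thesis
    using c(1) openin_open_eq by blast
qed

lemma openin_patch:
  assumes "riemann_surface M A" "c \<in> A"
  shows "openin M (patch c)"
  using assms unfolding riemann_surface_def by blast

lemma transition_analytic_at: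
  assumes "riemann_surface M A" "c \<in> A" "d \<in> A" "p \<in> patch c" "p \<in> patch d"
  shows "transition c d analytic_on {coord c p}"
proof -
  have "transition c d holomorphic_on coord c ` (patch c \<inter> patch d)"
    using assms unfolding riemann_surface_def by blast
  then show ?thesis
    using open_coord_overlap[OF assms(1,2) openin_patch[OF assms(1,3)]] assms
    by (auto simp: analytic_at)
qed

text \<open>This is the chain rule. The factorization of \<open>transition b d\<close> through c is
  available only on the triple overlap, which is open and therefore determines the derivative at
  p.\<close>

lemma deriv_transition_cocycle:
  assumes RS: "riemann_surface M A" and A: "b \<in> A" "c \<in> A" "d \<in> A"
    and p: "p \<in> patch b" "p \<in> patch c" "p \<in> patch d"
  shows "deriv (transition b d) (coord b p) =
    deriv (transition c d) (coord c p) * deriv (transition b c) (coord b p)"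
proof -
  let ?S = "coord b ` (patch b \<inter> (patch c \<inter> patch d))"
  have "transition b d z = (transition c d \<circ> transition b c) z" if "z \<in> ?S" for z
    using that by (auto simp: transition_coord[OF RS] A)
  moreover have "open ?S"
    using open_coord_overlap[OF RS A(1)] openin_patch[OF RS] A by blast
  moreover have "coord b p \<in> ?S"
    using p by blast
  ultimately have "\<forall>\<^sub>F z in nhds (coord b p). transition b d z = (transition c d \<circ> transition b c) z"
    unfolding eventually_nhds by blast
  then have "deriv (transition b d) (coord b p) =
      deriv (transition c d \<circ> transition b c) (coord b p)"
    by (rule deriv_cong_ev) simp
  also have "\<dots> = deriv (transition c d) (transition b c (coord b p)) *
      deriv (transition b c) (coord b p)"
    using transition_analytic_at[OF RS A(1,2) p(1,2)] transition_analytic_at[OF RS A(2,3) p(2,3)]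
    by (intro deriv_chain)
      (simp_all add: transition_coord[OF RS A(1) p(1)] analytic_on_imp_differentiable_at)
  finally show ?thesis
    by (simp add: transition_coord[OF RS] A p)
qed

section \<open>Chart independence of pairing, metric and magnitude\<close>

lemma chart_at:
  assumes "c \<in> A" "p \<in> patch c"
  shows "chart_at A p \<in> A" "p \<in> patch (chart_at A p)"
  using someI[of "\<lambda>c. c \<in> A \<and> p \<in> patch c" c] assms by (auto simp: chart_at_def)

lemma tangent_transition:
  assumes "X \<in> tangent A p" "c \<in> A" "d \<in> A" "p \<in> patch c" "p \<in> patch d"
  shows "X d = deriv (transition c d) (coord c p) * X c"
  using assms unfolding tangent_def by blast

lemma meromorphic_differential_transition:
  assumes "riemann_surface M A" "meromorphic_differential A \<omega>"
    and "c \<in> A" "d \<in> A" "p \<in> patch c" "p \<in> patch d"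
  shows "\<omega> c (coord c p) = \<omega> d (coord d p) * deriv (transition c d) (coord c p)"
proof -
  have "\<omega> c (coord c p) =
      \<omega> d (transition c d (coord c p)) * deriv (transition c d) (coord c p)"
    using assms unfolding meromorphic_differential_def by blast
  then show ?thesis
    by (simp add: transition_coord[OF assms(1,3,5)])
qed

lemma conformal_metric_transition:
  assumes "riemann_surface M A" "conformal_metric A \<rho>"
    and "c \<in> A" "d \<in> A" "p \<in> patch c" "p \<in> patch d"
  shows "\<rho> c (coord c p) = \<rho> d (coord d p) * norm (deriv (transition c d) (coord c p))"
proof -
  have "\<rho> c (coord c p) =
      \<rho> d (transition c d (coord c p)) * norm (deriv (transition c d) (coord c p))"
    using assms unfolding conformal_metric_def by blast
  then show ?thesis
    by (simp add: transition_coord[OF assms(1,3,5)])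
qed

lemma conformal_metric_pos:
  assumes "conformal_metric A \<rho>" "c \<in> A" "p \<in> patch c"
  shows "\<rho> c (coord c p) > 0"
  using assms unfolding conformal_metric_def by blast

text \<open>The derivative of the transition map appears once in the change of chart: as a factor of
  the coefficient of \<omega> on one side, and of the component of X on the other.\<close>

lemma pairing_in_chart:
  assumes "riemann_surface M A" "meromorphic_differential A \<omega>"
    and "X \<in> tangent A p" "c \<in> A" "p \<in> patch c"
  shows "pairing A \<omega> p X = \<omega> c (coord c p) * X c"
proof -
  note b = chart_at[OF assms(4,5)]
  show ?thesis
    using meromorphic_differential_transition[OF assms(1,2) b(1) assms(4) b(2) assms(5)]
      tangent_transition[OF assms(3) b(1) assms(4) b(2) assms(5)]
    by (simp add: pairing_def Let_def)
qed

text \<open>The metric coefficient changes by the squared modulus of the transition derivative.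
  Written as the derivative times its conjugate, one factor goes to X and the other to the
  conjugated Y.\<close>

lemma herm_metric_in_chart:
  assumes "riemann_surface M A" "conformal_metric A \<rho>"
    and "X \<in> tangent A p" "Y \<in> tangent A p" "c \<in> A" "p \<in> patch c"
  shows "herm_metric A \<rho> p X Y = of_real ((\<rho> c (coord c p))\<^sup>2) * X c * cnj (Y c)"
proof -
  note b = chart_at[OF assms(5,6)]
  let ?D = "deriv (transition (chart_at A p) c) (coord (chart_at A p) p)"
  have D: "of_real ((norm ?D)\<^sup>2) = ?D * cnj ?D"
    by (simp only: complex_norm_square)
  show ?thesis
    unfolding herm_metric_def Let_def
      conformal_metric_transition[OF assms(1,2) b(1) assms(5) b(2) assms(6)]
      tangent_transition[OF assms(3) b(1) assms(5) b(2) assms(6)]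
      tangent_transition[OF assms(4) b(1) assms(5) b(2) assms(6)]
      power_mult_distrib of_real_mult D
    by (simp add: mult_ac)
qed

lemma magnitude_in_chart:
  assumes "riemann_surface M A" "conformal_metric A \<rho>"
    and "X \<in> tangent A p" "c \<in> A" "p \<in> patch c"
  shows "magnitude A \<rho> p X = \<rho> c (coord c p) * norm (X c)"
proof -
  have "herm_metric A \<rho> p X X = of_real ((\<rho> c (coord c p) * norm (X c))\<^sup>2)"
    unfolding herm_metric_in_chart[OF assms(1,2,3,3,4,5)] power_mult_distrib of_real_mult
      complex_norm_square by (simp add: mult_ac)
  then show ?thesis
    using conformal_metric_pos[OF assms(2,4,5)] by (simp add: magnitude_def)
qed

text \<open>Supplies a nonzero vector against which a duality relation can be tested and then
  cancelled. It is the coordinate field of c carried to the other charts, with the cocycle identity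
  as consistency condition; its component in c is the derivative of
  \<open>transition c c\<close>.\<close>

lemma tangent_with_component:
  assumes RS: "riemann_surface M A" and c: "c \<in> A" "p \<in> patch c"
    and nz: "deriv (transition c c) (coord c p) \<noteq> 0"
  obtains X where "X \<in> tangent A p" "X c \<noteq> 0"
proof
  let ?X = "\<lambda>d. if d \<in> A \<and> p \<in> patch d then deriv (transition c d) (coord c p) else 0"
  show "?X \<in> tangent A p"
    unfolding tangent_def by (auto intro: deriv_transition_cocycle[OF RS c(1) _ _ c(2)])
  show "?X c \<noteq> 0"
    using nz c by simp
qed

section \<open>Components of the two dual fields\<close>

lemma nonpoles_in_patch:
  assumes "p \<in> nonpoles A \<omega>"
  obtains c where "c \<in> A" "p \<in> patch c"
  using assms by (auto simp: nonpoles_def)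

text \<open>One nonzero test vector suffices, since its component cancels from both sides;
  conjugation then isolates Y. The factor \<open>(\<rho> c (coord c p))\<^sup>2\<close> stays on the
  left because \<open>ideal_flow\<close> differentiates exactly this product.\<close>

lemma metric_dual_in_chart:
  assumes "riemann_surface M A" "meromorphic_differential A \<omega>" "conformal_metric A \<rho>"
    and "metric_dual A \<rho> \<omega> Y" "p \<in> nonpoles A \<omega>" and c: "c \<in> A" "p \<in> patch c"
  shows "of_real ((\<rho> c (coord c p))\<^sup>2) * Y p c = cnj (\<omega> c (coord c p))"
proof -
  have Y: "Y p \<in> tangent A p"
      "\<And>X. X \<in> tangent A p \<Longrightarrow> herm_metric A \<rho> p X (Y p) = pairing A \<omega> p X"
    using assms(4,5) unfolding metric_dual_def by blast+
  \<comment> \<open>The transformation law of \<rho> from c to itself would force \<rho> to vanish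
    if this derivative did, against positivity.\<close>
  have "deriv (transition c c) (coord c p) \<noteq> 0"
    using conformal_metric_transition[OF assms(1,3) c(1) c(1) c(2) c(2)]
      conformal_metric_pos[OF assms(3) c] by auto
  then obtain X where X: "X \<in> tangent A p" "X c \<noteq> 0"
    using tangent_with_component[OF assms(1) c] by metis
  have "of_real ((\<rho> c (coord c p))\<^sup>2) * cnj (Y p c) = \<omega> c (coord c p)"
    using Y(2)[OF X(1)] X(2) herm_metric_in_chart[OF assms(1,3) X(1) Y(1) c]
      pairing_in_chart[OF assms(1,2) X(1) c] by (simp add: mult_ac)
  from arg_cong[OF this, of cnj] show ?thesis
    by simp
qed

lemma dual_vector_field_in_chart:
  assumes "riemann_surface M A" "meromorphic_differential A \<omega>"
    and "dual_vector_field A \<omega> W" "p \<in> regular_points A \<omega>" "c \<in> A" "p \<in> patch c"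
  shows "\<omega> c (coord c p) \<noteq> 0" "W p c = 1 / \<omega> c (coord c p)"
proof -
  have W: "W p \<in> tangent A p" "pairing A \<omega> p (W p) = 1"
    using assms(3,4) unfolding dual_vector_field_def by blast+
  then have "\<omega> c (coord c p) * W p c = 1"
    using pairing_in_chart[OF assms(1,2) W(1) assms(5,6)] by simp
  then show "\<omega> c (coord c p) \<noteq> 0" "W p c = 1 / \<omega> c (coord c p)"
    by (auto simp: eq_divide_eq mult.commute)
qed

section \<open>Openness of the set of non-poles\<close>

lemma nonpoles_analytic_at:
  assumes "meromorphic_differential A \<omega>" "p \<in> nonpoles A \<omega>" "c \<in> A" "p \<in> patch c"
  shows "\<omega> c analytic_on {coord c p}"
proof (rule nicely_meromorphic_on_imp_analytic_at)
  show "\<omega> c nicely_meromorphic_on coord c ` patch c"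
    using assms(1,3) by (simp add: meromorphic_differential_def)
  show "coord c p \<in> coord c ` patch c" "\<not> is_pole (\<omega> c) (coord c p)"
    using assms(2-4) by (auto simp: nonpoles_def poles_def)
qed

text \<open>Being a non-pole is a condition on all charts through p. Analyticity in one chart passes
  to any other, because there \<omega> is locally the pullback under an analytic transition map
  times the analytic derivative of that map.\<close>

lemma analytic_at_nonpoles:
  assumes RS: "riemann_surface M A" and \<omega>: "meromorphic_differential A \<omega>"
    and c: "c \<in> A" "p \<in> patch c" and an: "\<omega> c analytic_on {coord c p}"
  shows "p \<in> nonpoles A \<omega>"
proof -
  have "\<not> is_pole (\<omega> d) (coord d p)" if d: "d \<in> A" "p \<in> patch d" for d
  proof -
    let ?S = "coord d ` (patch d \<inter> patch c)"
    let ?g = "\<lambda>z. (\<omega> c \<circ> transition d c) z * deriv (transition d c) z"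
    have T: "transition d c analytic_on {coord d p}"
      using transition_analytic_at[OF RS d(1) c(1) d(2) c(2)] .
    have "open ?S" "coord d p \<in> ?S"
      using open_coord_overlap[OF RS d(1) openin_patch[OF RS c(1)]] c d by auto
    moreover have "\<omega> d z = ?g z" if "z \<in> ?S" for z
      using \<omega> c(1) d(1) that by (auto simp: meromorphic_differential_def)
    ultimately have ev: "\<forall>\<^sub>F z in nhds (coord d p). \<omega> d z = ?g z"
      unfolding eventually_nhds by blast
    have "?g analytic_on {coord d p}"
      using T an by (intro analytic_on_mult analytic_on_compose analytic_deriv)
        (auto simp: transition_coord[OF RS d])
    then have "\<omega> d analytic_on {coord d p}"
      using analytic_at_cong[OF ev refl] by simp
    then show ?thesis
      by (rule analytic_at_imp_no_pole)
  qed
  then show ?thesis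
    using c by (auto simp: nonpoles_def poles_def)
qed

text \<open>Analyticity at a point persists in a neighbourhood. This is what allows the formula for
  Y, known only at non-poles, to be differentiated.\<close>

lemma eventually_nonpoles:
  assumes RS: "riemann_surface M A" and \<omega>: "meromorphic_differential A \<omega>"
    and c: "c \<in> A" "p \<in> patch c" and p: "p \<in> nonpoles A \<omega>"
  shows "\<forall>\<^sub>F z in nhds (coord c p). z \<in> coord c ` (patch c \<inter> nonpoles A \<omega>)"
proof -
  obtain U where U: "open U" "coord c p \<in> U" "\<omega> c holomorphic_on U"
    using nonpoles_analytic_at[OF \<omega> p c] by (auto simp: analytic_at)
  have "open (coord c ` patch c)"
    using RS c(1) unfolding riemann_surface_def by blast
  moreover have "z \<in> coord c ` (patch c \<inter> nonpoles A \<omega>)" if "z \<in> U \<inter> coord c ` patch c" for z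
  proof -
    obtain q where q: "q \<in> patch c" "z = coord c q"
      using \<open>z \<in> U \<inter> coord c ` patch c\<close> by blast
    then have "\<omega> c analytic_on {coord c q}"
      using U that by (auto simp: analytic_at)
    from analytic_at_nonpoles[OF RS \<omega> c(1) q(1) this] q show ?thesis
      by blast
  qed
  ultimately show ?thesis
    unfolding eventually_nhds using U c(2) by (intro exI[of _ "U \<inter> coord c ` patch c"]) auto
qed

section \<open>Ideal flow, moving equipotentials, and reciprocity\<close>

lemma metric_dual_ideal_flow:
  assumes RS: "riemann_surface M A" and \<omega>: "meromorphic_differential A \<omega>"
    and \<rho>: "conformal_metric A \<rho>" and Y: "metric_dual A \<rho> \<omega> Y"
  shows "ideal_flow A \<rho> (nonpoles A \<omega>) Y"
  unfolding ideal_flow_def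
proof (intro ballI)
  fix c z assume c: "c \<in> A" and "z \<in> coord c ` (patch c \<inter> nonpoles A \<omega>)"
  then obtain p where p: "p \<in> patch c" "p \<in> nonpoles A \<omega>" "z = coord c p"
    by blast
  let ?F = "\<lambda>\<zeta>. of_real ((\<rho> c \<zeta>)\<^sup>2) * Y (point c \<zeta>) c"
  have eq: "?F \<zeta> = cnj (\<omega> c \<zeta>)" if "\<zeta> \<in> coord c ` (patch c \<inter> nonpoles A \<omega>)" for \<zeta>
    using that metric_dual_in_chart[OF RS \<omega> \<rho> Y _ c] point_coord[OF RS c] by auto
  have ev: "\<forall>\<^sub>F \<zeta> in nhds z. cnj (\<omega> c \<zeta>) = ?F \<zeta>"
    using eventually_nonpoles[OF RS \<omega> c p(1,2)] unfolding p(3)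
    by (rule eventually_mono) (simp only: eq)
  \<comment> \<open>With a the derivative of \<open>\<omega> c\<close> at z, this map sends 1 to the
    conjugate of a and \<i> to -\<i> times that conjugate. The divergence and curl conditions are
    thus the Cauchy-Riemann equations for the conjugate of \<open>?F\<close>.\<close>
  let ?D = "\<lambda>h. cnj (deriv (\<omega> c) z * h)"
  have "(\<omega> c has_field_derivative deriv (\<omega> c) z) (at z)"
    using nonpoles_analytic_at[OF \<omega> p(2) c p(1)] p(3)
    by (simp add: DERIV_deriv_iff_field_differentiable analytic_on_imp_differentiable_at)
  then have "((\<lambda>\<zeta>. cnj (\<omega> c \<zeta>)) has_derivative ?D) (at z)"
    unfolding has_field_derivative_def by (rule has_derivative_cnj)
  then have "(?F has_derivative ?D) (at z)"
    by (rule has_derivative_transform_eventually)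
      (use ev in \<open>auto simp: eventually_nhds_conv_at\<close>)
  then show "\<exists>D. (?F has_derivative D) (at z) \<and>
        (Re (D 1) + Im (D \<i>)) / (\<rho> c z)\<^sup>2 = 0 \<and> (Im (D 1) - Re (D \<i>)) / (\<rho> c z)\<^sup>2 = 0"
    by (intro exI[of _ ?D]) simp
qed

lemma dual_velocity_of_equipotentials:
  assumes RS: "riemann_surface M A" and \<omega>: "meromorphic_differential A \<omega>"
    and W: "dual_vector_field A \<omega> W"
  shows "velocity_of_equipotentials A \<omega> W"
  unfolding velocity_of_equipotentials_def
proof (intro ballI allI impI)
  fix c V \<phi> z0 assume c: "c \<in> A" and pot: "potential A \<omega> c V \<phi>" and z0: "z0 \<in> V"
  have V: "open V" "V \<subseteq> coord c ` (patch c \<inter> regular_points A \<omega>)"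
    and der: "\<And>z. z \<in> V \<Longrightarrow> (\<phi> has_field_derivative \<omega> c z) (at z)"
    using pot unfolding potential_def by blast+
  have "\<omega> c z \<noteq> 0 \<and> W (point c z) c = 1 / \<omega> c z" if z: "z \<in> V" for z
  proof -
    obtain p where "p \<in> patch c" "p \<in> regular_points A \<omega>" "z = coord c p"
      using V(2) z by blast
    then show ?thesis
      using dual_vector_field_in_chart[OF RS \<omega> W _ c] point_coord[OF RS c] by simp
  qed
  then have nz: "\<And>z. z \<in> V \<Longrightarrow> \<omega> c z \<noteq> 0" and Wz: "\<And>z. z \<in> V \<Longrightarrow> W (point c z) c = 1 / \<omega> c z"
    by blast+
  \<comment> \<open>For w the coefficient of \<omega>, the two factors are the velocity and the
    tangent of the equipotential. They differ by a quarter turn, so the product is purely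
    imaginary.\<close>
  have orth: "Re (1 / w * cnj (\<i> / w)) = 0" for w :: complex
  proof -
    have "1 / w * cnj (\<i> / w) = - \<i> * (1 / w * cnj (1 / w))"
      by simp
    also have "\<dots> = - \<i> * of_real ((norm (1 / w))\<^sup>2)"
      by (simp only: complex_norm_square)
    finally show ?thesis
      by simp
  qed
  show "\<exists>N (\<epsilon>::real) (\<gamma> :: real \<Rightarrow> real \<Rightarrow> complex).
      open N \<and> z0 \<in> N \<and> N \<subseteq> V \<and> \<epsilon> > 0 \<and> \<gamma> (Re (\<phi> z0)) 0 = z0 \<and>
      (\<forall>t. \<bar>t - Re (\<phi> z0)\<bar> < \<epsilon> \<longrightarrow>
         bij_betw (\<gamma> t) {s. \<bar>s\<bar> < \<epsilon>} {z\<in>N. Re (\<phi> z) = t} \<and>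
         (\<forall>s. \<bar>s\<bar> < \<epsilon> \<longrightarrow>
            ((\<lambda>\<tau>. \<gamma> \<tau> s) has_vector_derivative W (point c (\<gamma> t s)) c) (at t) \<and>
            (\<exists>T. (\<gamma> t has_vector_derivative T) (at s) \<and> T \<noteq> 0 \<and>
                 Re (W (point c (\<gamma> t s)) c * cnj T) = 0)))"
  proof (rule equipotential_flow_box[OF V(1) z0 der nz])
    fix N and \<epsilon> :: real and \<gamma> :: "real \<Rightarrow> real \<Rightarrow> complex"
    assume box: "open N" "z0 \<in> N" "N \<subseteq> V" "\<epsilon> > 0" "\<gamma> (Re (\<phi> z0)) 0 = z0"
      and bij: "\<And>t. \<bar>t - Re (\<phi> z0)\<bar> < \<epsilon> \<Longrightarrow>
        bij_betw (\<gamma> t) {s. \<bar>s\<bar> < \<epsilon>} {z\<in>N. Re (\<phi> z) = t}"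
      and dt: "\<And>t s. \<bar>t - Re (\<phi> z0)\<bar> < \<epsilon> \<Longrightarrow> \<bar>s\<bar> < \<epsilon> \<Longrightarrow>
        ((\<lambda>\<tau>. \<gamma> \<tau> s) has_vector_derivative 1 / \<omega> c (\<gamma> t s)) (at t)"
      and ds: "\<And>t s. \<bar>t - Re (\<phi> z0)\<bar> < \<epsilon> \<Longrightarrow> \<bar>s\<bar> < \<epsilon> \<Longrightarrow>
        (\<gamma> t has_vector_derivative \<i> / \<omega> c (\<gamma> t s)) (at s)"
    show ?thesis
    proof (rule exI[of _ N], rule exI[of _ \<epsilon>], rule exI[of _ \<gamma>], intro conjI allI impI box bij)
      fix t s assume ts: "\<bar>t - Re (\<phi> z0)\<bar> < \<epsilon>" "\<bar>s\<bar> < \<epsilon>"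
      \<comment> \<open>The bijection onto the level set places \<open>\<gamma> t s\<close> in
        \<open>N\<close>, hence in the region where W is known to be the reciprocal of the
        coefficient.\<close>
      then have "\<gamma> t s \<in> V"
        using bij_betw_apply[OF bij[OF ts(1)], of s] box(3) by auto
      note * = nz[OF this] Wz[OF this]
      show "((\<lambda>\<tau>. \<gamma> \<tau> s) has_vector_derivative W (point c (\<gamma> t s)) c) (at t)"
        unfolding *(2) by (rule dt[OF ts])
      show "\<exists>T. (\<gamma> t has_vector_derivative T) (at s) \<and> T \<noteq> 0 \<and>
          Re (W (point c (\<gamma> t s)) c * cnj T) = 0"
        unfolding *(2)
      proof (intro exI conjI)
        show "(\<gamma> t has_vector_derivative \<i> / \<omega> c (\<gamma> t s)) (at s)"
          by (rule ds[OF ts])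
        show "\<i> / \<omega> c (\<gamma> t s) \<noteq> 0"
          using *(1) by simp
      qed (rule orth)
    qed
  qed
qed

lemma dual_fields_reciprocal:
  assumes RS: "riemann_surface M A" and \<omega>: "meromorphic_differential A \<omega>"
    and W: "dual_vector_field A \<omega> W" and \<rho>: "conformal_metric A \<rho>"
    and Y: "metric_dual A \<rho> \<omega> Y" and p: "p \<in> regular_points A \<omega>"
  shows "same_direction (W p) (Y p)" "magnitude A \<rho> p (W p) * magnitude A \<rho> p (Y p) = 1"
proof -
  have np: "p \<in> nonpoles A \<omega>"
    using p by (simp add: regular_points_def)
  obtain c where c: "c \<in> A" "p \<in> patch c"
    using nonpoles_in_patch[OF np] .
  define f r where "f = \<omega> c (coord c p)" and "r = \<rho> c (coord c p)"
  have r: "r > 0"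
    unfolding r_def by (rule conformal_metric_pos[OF \<rho> c])
  have f: "f \<noteq> 0" and Wc: "W p c = 1 / f"
    unfolding f_def using dual_vector_field_in_chart[OF RS \<omega> W p c] .
  have Yc: "Y p c = cnj f / of_real (r\<^sup>2)"
    using metric_dual_in_chart[OF RS \<omega> \<rho> Y np c] r
    by (simp add: f_def r_def field_simps)
  have tan: "W p \<in> tangent A p" "Y p \<in> tangent A p"
    using W Y p np unfolding dual_vector_field_def metric_dual_def by blast+
  show "magnitude A \<rho> p (W p) * magnitude A \<rho> p (Y p) = 1"
    unfolding magnitude_in_chart[OF RS \<rho> tan(1) c] magnitude_in_chart[OF RS \<rho> tan(2) c]
      r_def[symmetric] Wc Yc
    using r f by (simp add: norm_divide norm_mult power2_eq_square)
  \<comment> \<open>This is the quotient of the two components: \<open>1 / f\<close> is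
    \<open>cnj f\<close> over the squared modulus of f, whereas Y has \<open>cnj f\<close> over
    \<open>r\<^sup>2\<close>.\<close>
  define l where "l = r\<^sup>2 / (norm f)\<^sup>2"
  have l: "l > 0"
    using r f by (simp add: l_def)
  have "W p c = of_real l * Y p c"
    using r f unfolding l_def Wc Yc of_real_divide complex_norm_square by (simp add: field_simps)
  \<comment> \<open>Between charts both components are multiplied by the same transition derivative,
    so the ratio l persists. Outside the charts through p both are 0 by the convention in
    \<open>tangent\<close>, which gives equality as functions.\<close>
  then have "W p d = of_real l * Y p d" for d
  proof (cases "d \<in> A \<and> p \<in> patch d")
    case True
    then show ?thesis
      using tangent_transition[OF tan(1) c(1) _ c(2), of d]
        tangent_transition[OF tan(2) c(1) _ c(2), of d] \<open>W p c = of_real l * Y p c\<close>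
      by (simp add: mult.left_commute)
  next
    case False
    then have "W p d = 0" "Y p d = 0"
      using tan unfolding tangent_def by blast+
    then show ?thesis
      by simp
  qed
  moreover have "W p c \<noteq> 0" "Y p c \<noteq> 0"
    using r f by (simp_all add: Wc Yc)
  ultimately show "same_direction (W p) (Y p)"
    unfolding same_direction_def fun_eq_iff using l by blast
qed

theorem corollary10:
  fixes M :: "'a topology" and A :: "'a chart set"
    and \<omega> :: "'a chart \<Rightarrow> complex \<Rightarrow> complex"
    and \<rho> :: "'a chart \<Rightarrow> complex \<Rightarrow> real"
    and W Y :: "'a \<Rightarrow> 'a vec10"
  assumes "riemann_surface M A"
    and "meromorphic_differential A \<omega>"
    and "dual_vector_field A \<omega> W"
    and "conformal_metric A \<rho>"
    and "metric_dual A \<rho> \<omega> Y"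
  shows "velocity_of_equipotentials A \<omega> W \<and>
    ideal_flow A \<rho> (nonpoles A \<omega>) Y \<and>
    (\<forall>p\<in>regular_points A \<omega>.
       same_direction (W p) (Y p) \<and> magnitude A \<rho> p (W p) * magnitude A \<rho> p (Y p) = 1)"
  using dual_velocity_of_equipotentials[OF assms(1-3)]
    metric_dual_ideal_flow[OF assms(1,2,4,5)] dual_fields_reciprocal[OF assms]
  by (intro conjI ballI)

end
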